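(* The map $\mu$ induces a bijection, $\{S,S^\perp\}\mapsto\mu(S)$, between symplectic splittings $V=S\oplus S^\perp$ and spacelike lines in $W$. Moreover, under the Plücker embedding $\iota$, the Einstein torus defined by the symplectic splitting $S\oplus S^\perp$ is sent to the Einstein torus defined by the spacelike line $\mu(S)\subset W$.
   Context: Let $(V,\omega)$ be a $4$-dimensional real symplectic vector space; view $\omega$ also as a linear functional on $\Lambda^2 V$ via $\omega(u\wedge v)=\omega(u,v)$. Let $\mathrm{vol}\in\Lambda^4V$ be the element with $(\omega\wedge\omega)(\mathrm{vol})=-2$; equivalently $\mathrm{vol}=-u\wedge v\wedge u'\wedge v'$ whenever $\omega(u,v)=\omega(u',v')=1$ and all other products among $u,v,u',v'$ vanish. Let $\cdot$ be the nondegenerate symmetric bilinear form of signature $(3,3)$ on $\Lambda^2V$ given by $\alpha\wedge\beta=(\alpha\cdot\beta)\,\mathrm{vol}$. Let $W=\ker(\omega)\subset\Lambda^2V$, on which $\cdot$ has signature $(3,2)$. Let $\omega^*\in\Lambda^2V$ be defined by $\omega^*\cdot(u\wedge v)=\omega(u,v)$ for all $u,v\in V$; one has $\omega^*\cdot\omega^*=-2$ and $W=(\omega^* )^\perp$. The Plücker embedding is $\iota:\mathrm{Gr}(2,V)\to\mathbb P(\Lambda^2V)$, $\iota(\mathrm{span}(u,v))=[u\wedge v]$; it maps Lagrangian planes of $V$ bijectively onto the null lines of $W$. A $2$-plane $S\subset V$ is nondegenerate if $\omega|_S$ is nondegenerate; then $S^\perp=\{v:\omega(v,S)=0\}$ is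 a nondegenerate $2$-plane and $V=S\oplus S^\perp$. A symplectic splitting is such an (unordered) decomposition $V=S\oplus S^\perp$ with $S$ nondegenerate. The map $\mu$ sends a $2$-plane $S$ to $\mu(S)=\left[\hat\sigma+\tfrac12\omega(\hat\sigma)\omega^*\right]\in\mathbb P(W)$, where $\hat\sigma\in\Lambda^2V$ is any nonzero representative of $\iota(S)$ (so $\mu$ is $\iota$ followed by orthogonal projection to $W$); one has $\mu(S)=\mu(S^\perp)$ for $S$ nondegenerate. A line in $W$ is spacelike if spanned by a vector $s$ with $s\cdot s>0$. The Einstein torus defined by a spacelike line $\mathbb R s\subset W$ is the set of null lines of $W$ contained in $s^\perp$. The Einstein torus defined by the splitting $S\oplus S^\perp$ is the set of Lagrangian planes of $V$ not transverse to $S$ (equivalently, not transverse to $S^\perp$). *)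

theory Defs
  imports "HOL-Analysis.Analysis"
begin

section \<open>Duals, alternating forms and exterior powers\<close>

typedef (overloaded) 'a dual = "{f :: 'a::real_vector \<Rightarrow> real. linear f}"
  morphisms dual_app Dual
  by (auto intro!: exI[of _ "\<lambda>_. 0"] linearI)

setup_lifting type_definition_dual

instantiation dual :: (real_vector) real_vector
begin

lift_definition zero_dual :: "'a dual" is "\<lambda>_. 0"
  by (auto intro!: linearI)
lift_definition plus_dual :: "'a dual \<Rightarrow> 'a dual \<Rightarrow> 'a dual" is "\<lambda>f g x. f x + g x"
  by (rule linear_compose_add)
lift_definition minus_dual :: "'a dual \<Rightarrow> 'a dual \<Rightarrow> 'a dual" is "\<lambda>f g x. f x - g x"
  by (rule linear_compose_sub)
lift_definition uminus_dual :: "'a dual \<Rightarrow> 'a dual" is "\<lambda>f x. - f x"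
  by (rule linear_compose_neg)
lift_definition scaleR_dual :: "real \<Rightarrow> 'a dual \<Rightarrow> 'a dual" is "\<lambda>r f x. r *\<^sub>R f x"
  by (rule linear_compose_scale_right)

instance
  by standard (transfer; force simp: algebra_simps)+

end

definition alternating2 :: "('v::real_vector \<Rightarrow> 'v \<Rightarrow> real) \<Rightarrow> bool" where
  "alternating2 \<phi> \<longleftrightarrow> bilinear \<phi> \<and> (\<forall>u. \<phi> u u = 0)"

definition alternating4 :: "('v::real_vector \<Rightarrow> 'v \<Rightarrow> 'v \<Rightarrow> 'v \<Rightarrow> real) \<Rightarrow> bool" where
  "alternating4 \<Psi> \<longleftrightarrow>
     (\<forall>b c d. linear (\<lambda>a. \<Psi> a b c d)) \<and> (\<forall>a c d. linear (\<lambda>b. \<Psi> a b c d)) \<and>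
     (\<forall>a b d. linear (\<lambda>c. \<Psi> a b c d)) \<and> (\<forall>a b c. linear (\<lambda>d. \<Psi> a b c d)) \<and>
     (\<forall>a b c d. a = b \<or> a = c \<or> a = d \<or> b = c \<or> b = d \<or> c = d \<longrightarrow> \<Psi> a b c d = 0)"

typedef (overloaded) 'v alt2 = "{\<phi> :: 'v::real_vector \<Rightarrow> 'v \<Rightarrow> real. alternating2 \<phi>}"
  morphisms alt2_app Alt2
  by (rule exI[of _ "\<lambda>_ _. 0"]) (auto simp: alternating2_def bilinear_def intro!: linearI)

typedef (overloaded) 'v alt4 =
    "{\<Psi> :: 'v::real_vector \<Rightarrow> 'v \<Rightarrow> 'v \<Rightarrow> 'v \<Rightarrow> real. alternating4 \<Psi>}"
  morphisms alt4_app Alt4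
  by (rule exI[of _ "\<lambda>_ _ _ _. 0"]) (auto simp: alternating4_def intro!: linearI)

setup_lifting type_definition_alt2
setup_lifting type_definition_alt4

instantiation alt2 :: (real_vector) real_vector
begin

lift_definition zero_alt2 :: "'a alt2" is "\<lambda>_ _. 0"
  by (auto simp: alternating2_def bilinear_def intro!: linearI)
lift_definition plus_alt2 :: "'a alt2 \<Rightarrow> 'a alt2 \<Rightarrow> 'a alt2" is "\<lambda>f g x y. f x y + g x y"
  by (auto simp: alternating2_def bilinear_def intro: linear_compose_add)
lift_definition minus_alt2 :: "'a alt2 \<Rightarrow> 'a alt2 \<Rightarrow> 'a alt2" is "\<lambda>f g x y. f x y - g x y"
  by (auto simp: alternating2_def bilinear_def intro: linear_compose_sub)
lift_definition uminus_alt2 :: "'a alt2 \<Rightarrow> 'a alt2" is "\<lambda>f x y. - f x y"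
  by (auto simp: alternating2_def bilinear_def intro: linear_compose_neg)
lift_definition scaleR_alt2 :: "real \<Rightarrow> 'a alt2 \<Rightarrow> 'a alt2" is "\<lambda>r f x y. r *\<^sub>R f x y"
  unfolding alternating2_def bilinear_def
  by (auto intro: linear_compose_scale_right simp del: real_scaleR_def)

instance
  by standard (transfer; force simp: algebra_simps)+

end

instantiation alt4 :: (real_vector) real_vector
begin

lift_definition zero_alt4 :: "'a alt4" is "\<lambda>_ _ _ _. 0"
  by (auto simp: alternating4_def intro!: linearI)
lift_definition plus_alt4 :: "'a alt4 \<Rightarrow> 'a alt4 \<Rightarrow> 'a alt4"
  is "\<lambda>f g a b c d. f a b c d + g a b c d"
  by (fastforce simp: alternating4_def intro: linear_compose_add)
lift_definition minus_alt4 :: "'a alt4 \<Rightarrow> 'a alt4 \<Rightarrow> 'a alt4"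
  is "\<lambda>f g a b c d. f a b c d - g a b c d"
  by (fastforce simp: alternating4_def intro: linear_compose_sub)
lift_definition uminus_alt4 :: "'a alt4 \<Rightarrow> 'a alt4" is "\<lambda>f a b c d. - f a b c d"
  by (fastforce simp: alternating4_def intro: linear_compose_neg)
lift_definition scaleR_alt4 :: "real \<Rightarrow> 'a alt4 \<Rightarrow> 'a alt4"
  is "\<lambda>r f a b c d. r *\<^sub>R f a b c d"
  unfolding alternating4_def
  by (fastforce intro: linear_compose_scale_right simp del: real_scaleR_def)

instance
  by standard (transfer; force simp: algebra_simps)+

end

text \<open>
  For a finite-dimensional space \<open>V\<close> the exterior power \<open>\<Lambda>\<^sup>k V\<close> is canonically the dual of the
  space of alternating \<open>k\<close>-linear forms on \<open>V\<close>, the decomposable vector \<open>v\<^sub>1 \<and> \<dots> \<and> v\<^sub>k\<close> being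
  the evaluation of forms at \<open>(v\<^sub>1, \<dots>, v\<^sub>k)\<close>. In infinite dimension these types are too big.
\<close>

type_synonym 'v ext2 = "'v alt2 dual"
type_synonym 'v ext4 = "'v alt4 dual"

lift_definition wedge :: "'v::real_vector \<Rightarrow> 'v \<Rightarrow> 'v ext2" is "\<lambda>u v \<phi>. alt2_app \<phi> u v"
  by (auto intro!: linearI simp: plus_alt2.rep_eq scaleR_alt2.rep_eq)

lift_definition wedge4 :: "'v::real_vector \<Rightarrow> 'v \<Rightarrow> 'v \<Rightarrow> 'v \<Rightarrow> 'v ext4"
  is "\<lambda>a b c d \<Psi>. alt4_app \<Psi> a b c d"
  by (auto intro!: linearI simp: plus_alt4.rep_eq scaleR_alt4.rep_eq)

lift_definition slice :: "'v::real_vector alt4 \<Rightarrow> 'v \<Rightarrow> 'v \<Rightarrow> 'v alt2"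
  is "\<lambda>\<Psi> a b c d. \<Psi> a b c d"
  by (auto simp: alternating4_def alternating2_def bilinear_def)

lemma dual_app_linear: "linear (dual_app f)"
  using dual_app[of f] by simp

lemma slice_linear:
  "slice \<Psi> (a + a') b = slice \<Psi> a b + slice \<Psi> a' b"
  "slice \<Psi> a (b + b') = slice \<Psi> a b + slice \<Psi> a b'"
  "slice \<Psi> (r *\<^sub>R a) b = r *\<^sub>R slice \<Psi> a b"
  "slice \<Psi> a (r *\<^sub>R b) = r *\<^sub>R slice \<Psi> a b"
  "slice \<Psi> a a = 0"
  "slice (\<Psi> + \<Psi>') a b = slice \<Psi> a b + slice \<Psi>' a b"
  "slice (r *\<^sub>R \<Psi>) a b = r *\<^sub>R slice \<Psi> a b"
  by (transfer; auto simp: alternating4_def linear_iff fun_eq_iff)+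

lift_definition contract :: "'v::real_vector ext2 \<Rightarrow> 'v alt4 \<Rightarrow> 'v alt2"
  is "\<lambda>\<beta> \<Psi> a b. \<beta> (slice \<Psi> a b)"
  by (auto simp: alternating2_def bilinear_def slice_linear linear_add linear_cmul linear_0
      intro!: linearI)

lift_definition wedge22 :: "'v::real_vector ext2 \<Rightarrow> 'v ext2 \<Rightarrow> 'v ext4"
  is "\<lambda>\<alpha> \<beta> \<Psi>. dual_app \<alpha> (contract \<beta> \<Psi>)"
proof -
  fix \<alpha> \<beta> :: "'v ext2"
  have "contract \<beta> (\<Psi> + \<Psi>') = contract \<beta> \<Psi> + contract \<beta> \<Psi>'"
       "contract \<beta> (r *\<^sub>R \<Psi>) = r *\<^sub>R contract \<beta> \<Psi>" for \<Psi> \<Psi>' r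
    by (transfer; auto simp: slice_linear linear_add linear_cmul)+
  then show "linear (\<lambda>\<Psi>. dual_app \<alpha> (contract \<beta> \<Psi>))"
    using dual_app_linear[of \<alpha>] by (auto intro!: linearI simp: linear_add linear_cmul)
qed

text \<open>The product \<open>\<Lambda>\<^sup>2 V \<times> \<Lambda>\<^sup>2 V \<rightarrow> \<Lambda>\<^sup>4 V\<close> is the usual one on decomposable vectors.\<close>

lemma wedge22_wedge: "wedge22 (wedge a b) (wedge c d) = wedge4 a b c d"
  by (rule dual_app_inject[THEN iffD1])
     (simp add: fun_eq_iff wedge22.rep_eq wedge.rep_eq wedge4.rep_eq contract.rep_eq slice.rep_eq)

lemma alternating2_swap: "alternating2 \<phi> \<Longrightarrow> \<phi> v u = - \<phi> u v"
proof -
  assume "alternating2 \<phi>"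
  then have *: "bilinear \<phi>" and "\<phi> (u + v) (u + v) = 0" "\<phi> u u = 0" "\<phi> v v = 0"
    by (auto simp: alternating2_def)
  with * show ?thesis
    by (simp add: bilinear_ladd bilinear_radd)
qed

text \<open>The product of forms is normalised as a sum over shuffles (no factor \<open>1/4\<close>), so that
  \<open>\<omega> \<and> \<omega>\<close> takes the value \<open>2\<close> on a symplectic basis \<open>(u, v, u', v')\<close>.\<close>

lift_definition form_wedge :: "'v::real_vector alt2 \<Rightarrow> 'v alt2 \<Rightarrow> 'v alt4"
  is "\<lambda>\<phi> \<psi> a b c d. \<phi> a b * \<psi> c d - \<phi> a c * \<psi> b d + \<phi> a d * \<psi> b c
                   + \<phi> b c * \<psi> a d - \<phi> b d * \<psi> a c + \<phi> c d * \<psi> a b"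
proof -
  fix \<phi> \<psi> :: "'v \<Rightarrow> 'v \<Rightarrow> real"
  assume *: "alternating2 \<phi>" "alternating2 \<psi>"
  then have bl: "bilinear \<phi>" "bilinear \<psi>" and z: "\<And>u. \<phi> u u = 0" "\<And>u. \<psi> u u = 0"
    by (auto simp: alternating2_def)
  note sw = alternating2_swap[OF *(1)] alternating2_swap[OF *(2)]
  note lin = bl[THEN bilinear_ladd] bl[THEN bilinear_radd] bl[THEN bilinear_lmul]
    bl[THEN bilinear_rmul]
  show "alternating4 (\<lambda>a b c d. \<phi> a b * \<psi> c d - \<phi> a c * \<psi> b d + \<phi> a d * \<psi> b c
                   + \<phi> b c * \<psi> a d - \<phi> b d * \<psi> a c + \<phi> c d * \<psi> a b)"
    unfolding alternating4_def
  proof (intro conjI allI impI)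
    fix a b c d :: 'v
    assume "a = b \<or> a = c \<or> a = d \<or> b = c \<or> b = d \<or> c = d"
    then show "\<phi> a b * \<psi> c d - \<phi> a c * \<psi> b d + \<phi> a d * \<psi> b c
                   + \<phi> b c * \<psi> a d - \<phi> b d * \<psi> a c + \<phi> c d * \<psi> a b = 0"
      using sw[of a b] sw[of a c] sw[of a d] sw[of b c] sw[of b d] sw[of c d]
      by (elim disjE) (simp_all add: z)
  qed (auto intro!: linearI simp: lin algebra_simps)
qed

section \<open>The four-dimensional symplectic space\<close>

definition symplectic_form :: "('v::real_vector \<Rightarrow> 'v \<Rightarrow> real) \<Rightarrow> bool" where
  "symplectic_form \<omega> \<longleftrightarrow> alternating2 \<omega> \<and> (\<forall>u. (\<forall>v. \<omega> u v = 0) \<longrightarrow> u = 0)"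

definition form_eval :: "('v::real_vector \<Rightarrow> 'v \<Rightarrow> real) \<Rightarrow> 'v ext2 \<Rightarrow> real" where
  "form_eval \<omega> \<alpha> = dual_app \<alpha> (Alt2 \<omega>)"

lemma form_eval_wedge: "alternating2 \<omega> \<Longrightarrow> form_eval \<omega> (wedge u v) = \<omega> u v"
  by (simp add: form_eval_def wedge.rep_eq Alt2_inverse)

definition vol :: "('v::real_vector \<Rightarrow> 'v \<Rightarrow> real) \<Rightarrow> 'v ext4" where
  "vol \<omega> = (THE \<tau>. dual_app \<tau> (form_wedge (Alt2 \<omega>) (Alt2 \<omega>)) = -2)"

definition dot :: "('v::real_vector \<Rightarrow> 'v \<Rightarrow> real) \<Rightarrow> 'v ext2 \<Rightarrow> 'v ext2 \<Rightarrow> real" where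
  "dot \<omega> \<alpha> \<beta> = (THE r. wedge22 \<alpha> \<beta> = r *\<^sub>R vol \<omega>)"

definition W :: "('v::real_vector \<Rightarrow> 'v \<Rightarrow> real) \<Rightarrow> 'v ext2 set" where
  "W \<omega> = {\<alpha>. form_eval \<omega> \<alpha> = 0}"

definition omega_star :: "('v::real_vector \<Rightarrow> 'v \<Rightarrow> real) \<Rightarrow> 'v ext2" where
  "omega_star \<omega> = (THE \<alpha>. \<forall>u v. dot \<omega> \<alpha> (wedge u v) = \<omega> u v)"

section \<open>Planes and lines\<close>

text \<open>Points of the projective space of \<open>E\<close> are represented by the lines (one-dimensional
  subspaces) of \<open>E\<close>.\<close>

definition Gr2 :: "'v::real_vector set set" where
  "Gr2 = {S. subspace S \<and> dim S = 2}"

text \<open>The vectors \<open>u \<and> v\<close>, for \<open>(u, v)\<close> ranging over the bases of \<open>S\<close>, all span the same line.\<close>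

definition plucker :: "'v::real_vector set \<Rightarrow> 'v ext2 set" where
  "plucker S = (THE l. \<forall>u v. span {u, v} = S \<longrightarrow> l = span {wedge u v})"

definition mu :: "('v::real_vector \<Rightarrow> 'v \<Rightarrow> real) \<Rightarrow> 'v set \<Rightarrow> 'v ext2 set" where
  "mu \<omega> S = (THE l. \<forall>\<sigma> \<in> plucker S - {0}.
     l = span {\<sigma> + (form_eval \<omega> \<sigma> / 2) *\<^sub>R omega_star \<omega>})"

definition symp_orth :: "('v::real_vector \<Rightarrow> 'v \<Rightarrow> real) \<Rightarrow> 'v set \<Rightarrow> 'v set" where
  "symp_orth \<omega> S = {v. \<forall>s\<in>S. \<omega> v s = 0}"

definition nondegenerate_plane :: "('v::real_vector \<Rightarrow> 'v \<Rightarrow> real) \<Rightarrow> 'v set \<Rightarrow> bool" where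
  "nondegenerate_plane \<omega> S \<longleftrightarrow> S \<in> Gr2 \<and> (\<forall>u\<in>S. (\<forall>v\<in>S. \<omega> u v = 0) \<longrightarrow> u = 0)"

definition symplectic_splittings :: "('v::real_vector \<Rightarrow> 'v \<Rightarrow> real) \<Rightarrow> 'v set set set" where
  "symplectic_splittings \<omega> = {{S, symp_orth \<omega> S} | S. nondegenerate_plane \<omega> S}"

definition lagrangian_plane :: "('v::real_vector \<Rightarrow> 'v \<Rightarrow> real) \<Rightarrow> 'v set \<Rightarrow> bool" where
  "lagrangian_plane \<omega> L \<longleftrightarrow> L \<in> Gr2 \<and> (\<forall>u\<in>L. \<forall>v\<in>L. \<omega> u v = 0)"

definition transverse :: "'v::real_vector set \<Rightarrow> 'v set \<Rightarrow> bool" where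
  "transverse A B \<longleftrightarrow> {a + b | a b. a \<in> A \<and> b \<in> B} = UNIV"

definition null_lines :: "('v::real_vector \<Rightarrow> 'v \<Rightarrow> real) \<Rightarrow> 'v ext2 set set" where
  "null_lines \<omega> = {span {x} | x. x \<in> W \<omega> \<and> x \<noteq> 0 \<and> dot \<omega> x x = 0}"

definition spacelike_lines :: "('v::real_vector \<Rightarrow> 'v \<Rightarrow> real) \<Rightarrow> 'v ext2 set set" where
  "spacelike_lines \<omega> = {span {s} | s. s \<in> W \<omega> \<and> dot \<omega> s s > 0}"

text \<open>The argument \<open>l\<close> is a spacelike line; orthogonality to \<open>l\<close> is orthogonality to any
  vector spanning it.\<close>

definition torus_of_line ::
    "('v::real_vector \<Rightarrow> 'v \<Rightarrow> real) \<Rightarrow> 'v ext2 set \<Rightarrow> 'v ext2 set set" where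
  "torus_of_line \<omega> l = {n \<in> null_lines \<omega>. \<forall>x\<in>n. \<forall>s\<in>l. dot \<omega> x s = 0}"

text \<open>The torus defined by the splitting into \<open>S\<close> and its symplectic complement.\<close>

definition torus_of_splitting ::
    "('v::real_vector \<Rightarrow> 'v \<Rightarrow> real) \<Rightarrow> 'v set \<Rightarrow> 'v set set" where
  "torus_of_splitting \<omega> S = {L. lagrangian_plane \<omega> L \<and> \<not> transverse L S}"

end

(*
  For bivectors, \<alpha> \<cdot> \<beta> = -1/2 (\<omega> \<and> \<omega>)(\<alpha> \<and> \<beta>). Hence (a \<and> b) \<cdot> (c \<and> d) vanishes exactly when
  a, b, c, d fail to span V, that is, when span(a, b) and span(c, d) are not transverse; in
  particular a plane is recovered from its Pluecker point. In a symplectic basis (e, f, g, h) one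
  has \<omega>* = - e \<and> f - g \<and> h, and the six Pluecker coordinates show that a null bivector is
  decomposable.

  If S = span(u, v) with \<omega>(u, v) = 1, then \<mu>(S) is spanned by t = u \<and> v + \<omega>*/2, and t \<cdot> t = 1/2.
  Conversely, normalise a spacelike vector s of W to s \<cdot> s = 1/2; then s - \<omega>*/2 is null, hence
  decomposable, which gives surjectivity. As t is determined by its line up to sign, and the
  vector of the symplectic complement of S is -t, the splitting is determined by \<mu>(S). Finally,
  for a Lagrangian plane span(a, b) the vector a \<and> b is orthogonal to \<omega>*, so it is orthogonal to
  t iff it is orthogonal to u \<and> v, iff span(a, b) is not transverse to S.
*)
theory Submission
  imports Defs
begin

section \<open>Linear algebra of forms, duals and bivectors\<close>

lemma dual_eqI: "(\<And>\<phi>. dual_app \<alpha> \<phi> = dual_app \<beta> \<phi>) \<Longrightarrow> \<alpha> = \<beta>"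
  by (simp add: dual_app_inject[symmetric] fun_eq_iff)

lemma alt2_eqI: "(\<And>x y. alt2_app \<phi> x y = alt2_app \<psi> x y) \<Longrightarrow> \<phi> = \<psi>"
  by (simp add: alt2_app_inject[symmetric] fun_eq_iff)

lemma alt4_eqI: "(\<And>a b c d. alt4_app \<Phi> a b c d = alt4_app \<Psi> a b c d) \<Longrightarrow> \<Phi> = \<Psi>"
  by (simp add: alt4_app_inject[symmetric] fun_eq_iff)

lemma alternating2_alt2_app: "alternating2 (alt2_app \<phi>)"
  using alt2_app by blast

lemma alternating2_simps:
  assumes "alternating2 \<phi>"
  shows "\<phi> (a + a') b = \<phi> a b + \<phi> a' b" "\<phi> a (b + b') = \<phi> a b + \<phi> a b'"
    "\<phi> (a - a') b = \<phi> a b - \<phi> a' b" "\<phi> a (b - b') = \<phi> a b - \<phi> a b'"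
    "\<phi> (r *\<^sub>R a) b = r * \<phi> a b" "\<phi> a (r *\<^sub>R b) = r * \<phi> a b"
    "\<phi> (- a) b = - \<phi> a b" "\<phi> a (- b) = - \<phi> a b"
    "\<phi> 0 b = 0" "\<phi> a 0 = 0" "\<phi> a a = 0"
  using assms unfolding alternating2_def
  by (auto simp: bilinear_ladd bilinear_radd bilinear_lsub bilinear_rsub bilinear_lmul
      bilinear_rmul bilinear_lneg bilinear_rneg bilinear_lzero bilinear_rzero)

lemmas alt2_app_simps = alternating2_simps[OF alternating2_alt2_app]
lemmas alt2_app_swap = alternating2_swap[OF alternating2_alt2_app]

lemma dual_app_simps:
  "dual_app \<alpha> (\<phi> + \<psi>) = dual_app \<alpha> \<phi> + dual_app \<alpha> \<psi>"
  "dual_app \<alpha> (r *\<^sub>R \<phi>) = r * dual_app \<alpha> \<phi>"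
  "dual_app \<alpha> (- \<phi>) = - dual_app \<alpha> \<phi>"
  "dual_app \<alpha> (\<phi> - \<psi>) = dual_app \<alpha> \<phi> - dual_app \<alpha> \<psi>"
  "dual_app \<alpha> 0 = 0"
  using dual_app_linear[of \<alpha>]
  by (auto simp: linear_add linear_cmul linear_neg linear_diff linear_0)

lemmas dual_rep_simps = plus_dual.rep_eq scaleR_dual.rep_eq uminus_dual.rep_eq
  minus_dual.rep_eq zero_dual.rep_eq

lemma wedge_simps:
  "wedge (a + a') b = wedge a b + wedge a' b" "wedge a (b + b') = wedge a b + wedge a b'"
  "wedge (a - a') b = wedge a b - wedge a' b" "wedge a (b - b') = wedge a b - wedge a b'"
  "wedge (r *\<^sub>R a) b = r *\<^sub>R wedge a b" "wedge a (r *\<^sub>R b) = r *\<^sub>R wedge a b"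
  "wedge (- a) b = - wedge a b" "wedge a (- b) = - wedge a b"
  "wedge 0 b = 0" "wedge a 0 = 0" "wedge a a = 0"
  by (rule dual_eqI; simp add: wedge.rep_eq dual_rep_simps alt2_app_simps)+

lemma wedge_swap: "wedge v u = - wedge u v"
  by (rule dual_eqI) (simp add: wedge.rep_eq dual_rep_simps alt2_app_swap[of _ v u])

lemma linear_contract: "linear (\<lambda>\<beta>. contract \<beta> \<Psi>)"
  by (rule linearI; rule alt2_eqI)
     (simp_all add: contract.rep_eq dual_rep_simps plus_alt2.rep_eq scaleR_alt2.rep_eq)

section \<open>Alternating 4-forms and bases\<close>

lemma alternating4_alt4_app: "alternating4 (alt4_app \<Psi>)"
  using alt4_app by blast

lemma alternating4_swap:
  assumes "alternating4 \<Psi>"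
  shows "\<Psi> b a c d = - \<Psi> a b c d" "\<Psi> a c b d = - \<Psi> a b c d" "\<Psi> a b d c = - \<Psi> a b c d"
proof -
  have alt: "alternating2 (\<lambda>x y. \<Psi> x y c d)" "alternating2 (\<lambda>x y. \<Psi> a x y d)"
    "alternating2 (\<lambda>x y. \<Psi> a b x y)" for a b c d
    using assms by (auto simp: alternating4_def alternating2_def bilinear_def)
  show "\<Psi> b a c d = - \<Psi> a b c d" "\<Psi> a c b d = - \<Psi> a b c d" "\<Psi> a b d c = - \<Psi> a b c d"
    by (rule alternating2_swap[OF alt(1)] alternating2_swap[OF alt(2)]
        alternating2_swap[OF alt(3)])+
qed

lemma linear_eq_0_if_spanning:
  assumes "linear f" "\<And>y. y \<in> B \<Longrightarrow> f y = 0" "span B = UNIV"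
  shows "f x = 0"
proof -
  have "x \<in> span B" unfolding assms(3) by (rule UNIV_I)
  then show ?thesis using assms(1,2) by (rule linear_eq_0_on_span[rotated 2])
qed

text \<open>By multilinearity it suffices to insert vectors from \<open>{a, b, c, d}\<close>: a
  repetition gives zero, and otherwise the arguments are a permutation of \<open>a\<close>,
  \<open>b\<close>, \<open>c\<close>, \<open>d\<close>.\<close>

lemma alternating4_eq_0:
  assumes \<Psi>: "alternating4 \<Psi>" and span: "span {a, b, c, d} = UNIV" and 0: "\<Psi> a b c d = 0"
  shows "\<Psi> w x y z = 0"
proof -
  let ?B = "{a, b, c, d}"
  note swap = alternating4_swap[OF \<Psi>]
  have lin: "linear (\<lambda>w. \<Psi> w x y z)" "linear (\<lambda>x. \<Psi> w x y z)" "linear (\<lambda>y. \<Psi> w x y z)"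
    "linear (\<lambda>z. \<Psi> w x y z)" for w x y z
    using \<Psi> by (simp_all add: alternating4_def)
  have eq: "\<Psi> w x y z = 0" if "w = x \<or> w = y \<or> w = z \<or> x = y \<or> x = z \<or> y = z" for w x y z
    using \<Psi> that unfolding alternating4_def by blast
  \<comment> \<open>Vanishing survives each adjacent transposition of the arguments.\<close>
  have s: "\<Psi> x w y z = 0" "\<Psi> w y x z = 0" "\<Psi> w x z y = 0" if "\<Psi> w x y z = 0" for w x y z
    by (simp_all only: swap(1)[of x w y z] swap(2)[of w y x z] swap(3)[of w x z y] that minus_zero)
  \<comment> \<open>With \<open>a\<close> kept in front, these are the five nontrivial orderings of
    \<open>b\<close>, \<open>c\<close>, \<open>d\<close>.\<close>
  have perm: "\<Psi> a b d c = 0" "\<Psi> a c b d = 0" "\<Psi> a c d b = 0" "\<Psi> a d b c = 0" "\<Psi> a d c b = 0"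
    by (fact s(3)[OF 0] s(2)[OF 0] s(3)[OF s(2)[OF 0]] s(2)[OF s(3)[OF 0]]
        s(3)[OF s(2)[OF s(3)[OF 0]]])+
  have on_B: "\<Psi> w x y z = 0" if "w \<in> ?B" "x \<in> ?B" "y \<in> ?B" "z \<in> ?B" for w x y z
  proof -
    have a: "\<Psi> a x y z = 0" if "x \<in> ?B" "y \<in> ?B" "z \<in> ?B" for x y z
      using that by (elim insertE emptyE) (simp_all add: perm 0 eq)
    have b: "\<Psi> w a y z = 0" if "w \<in> ?B" "y \<in> ?B" "z \<in> ?B" for w y z
      by (rule s(1)) (rule a[OF that])
    have c: "\<Psi> w x a z = 0" if "w \<in> ?B" "x \<in> ?B" "z \<in> ?B" for w x z
      by (rule s(2)) (rule b[OF that])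
    have d: "\<Psi> w x y a = 0" if "w \<in> ?B" "x \<in> ?B" "y \<in> ?B" for w x y
      by (rule s(3)) (rule c[OF that])
    \<comment> \<open>If \<open>a\<close> occurs, it can be moved to the front; otherwise four slots
      filled from \<open>{b, c, d}\<close> force a repetition.\<close>
    consider "w = a" | "x = a" | "y = a" | "z = a" | "w \<noteq> a \<and> x \<noteq> a \<and> y \<noteq> a \<and> z \<noteq> a"
      by blast
    then show ?thesis
    proof cases
      case 5
      then have "w \<in> {b, c, d}" "x \<in> {b, c, d}" "y \<in> {b, c, d}" "z \<in> {b, c, d}"
        using that by simp_all
      then show ?thesis by (elim insertE emptyE) (simp_all add: eq)
    qed (use that in \<open>simp_all only: a b c d\<close>)
  qed
  \<comment> \<open>Extension from the spanning set to all vectors, one slot at a time, starting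
    with the last.\<close>
  have 3: "\<Psi> w x y z = 0" if "w \<in> ?B" "x \<in> ?B" "y \<in> ?B" for w x y z
    by (rule linear_eq_0_if_spanning[OF lin(4) _ span]) (rule on_B[OF that])
  have 2: "\<Psi> w x y z = 0" if "w \<in> ?B" "x \<in> ?B" for w x y z
    by (rule linear_eq_0_if_spanning[OF lin(3) _ span]) (rule 3[OF that])
  have 1: "\<Psi> w x y z = 0" if "w \<in> ?B" for w x y z
    by (rule linear_eq_0_if_spanning[OF lin(2) _ span]) (rule 2[OF that])
  show ?thesis
    by (rule linear_eq_0_if_spanning[OF lin(1) _ span]) (rule 1)
qed

text \<open>If one vector were in the span of the later ones, linearity in its slot would reduce the
  value to values with a repeated argument, all zero.\<close>

lemma independent_if_alternating4_neq_0:
  assumes \<Psi>: "alternating4 \<Psi>" and "\<Psi> a b c d \<noteq> 0"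
  shows "independent {a, b, c, d}" "card {a, b, c, d} = 4"
proof -
  have eq: "\<Psi> w x y z = 0" if "w = x \<or> w = y \<or> w = z \<or> x = y \<or> x = z \<or> y = z" for w x y z
    using \<Psi> that unfolding alternating4_def by blast
  have lin: "linear (\<lambda>w. \<Psi> w x y z)" "linear (\<lambda>x. \<Psi> w x y z)" "linear (\<lambda>y. \<Psi> w x y z)"
    "linear (\<lambda>z. \<Psi> w x y z)" for w x y z
    using \<Psi> by (simp_all add: alternating4_def)
  have "d \<noteq> 0" using linear_0[OF lin(4)] assms by metis
  moreover have "c \<notin> span {d}"
    using linear_eq_0_on_span[OF lin(3)[of a b d], of "{d}" c] eq assms by auto
  moreover have "b \<notin> span {c, d}"
    using linear_eq_0_on_span[OF lin(2)[of a c d], of "{c, d}" b] eq assms by auto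
  moreover have "a \<notin> span {b, c, d}"
    using linear_eq_0_on_span[OF lin(1)[of b c d], of "{b, c, d}" a] eq assms by auto
  ultimately show "independent {a, b, c, d}"
    by (auto simp: independent_insert span_base)
  have "distinct [a, b, c, d]" using eq assms by auto
  then show "card {a, b, c, d} = 4"
    using distinct_card[of "[a, b, c, d]"] by simp
qed

section \<open>Pluecker points of planes and decomposable bivectors\<close>

lemma span_pair: "x \<in> span {u, v} \<longleftrightarrow> (\<exists>r s. x = r *\<^sub>R u + s *\<^sub>R v)"
  by (simp add: span_breakdown_eq diff_diff_eq)

text \<open>Makes the \<open>THE\<close> well defined: two pairs with the same span have
  proportional wedges, and the inclusion of lines is used in both directions.\<close>

lemma plucker_span: "plucker (span {u, v}) = span {wedge u v}"
proof -
  have le: "span {wedge u v} \<subseteq> span {wedge u' v'}" if "span {u, v} = span {u', v'}"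
    for u v u' v' :: 'a
  proof -
    have "u \<in> span {u', v'}" "v \<in> span {u', v'}"
      using that span_base[of _ "{u, v}"] by auto
    then obtain a b c d where "u = a *\<^sub>R u' + b *\<^sub>R v'" "v = c *\<^sub>R u' + d *\<^sub>R v'"
      by (auto simp: span_pair)
    \<comment> \<open>The factor is the determinant of the coefficient matrix.\<close>
    then have "wedge u v = (a * d - b * c) *\<^sub>R wedge u' v'"
      by (simp add: wedge_simps wedge_swap[of v' u'] algebra_simps)
    then show ?thesis by (intro span_minimal) (simp_all add: span_scale span_base)
  qed
  then show ?thesis
    unfolding plucker_def by (intro the_equality) (metis subset_antisym)+
qed

lemma wedge22_bilinear:
  "dual_app (wedge22 (\<alpha> + \<alpha>') \<beta>) \<Psi> = dual_app (wedge22 \<alpha> \<beta>) \<Psi> + dual_app (wedge22 \<alpha>' \<beta>) \<Psi>"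
  "dual_app (wedge22 \<alpha> (\<beta> + \<beta>')) \<Psi> = dual_app (wedge22 \<alpha> \<beta>) \<Psi> + dual_app (wedge22 \<alpha> \<beta>') \<Psi>"
  "dual_app (wedge22 (r *\<^sub>R \<alpha>) \<beta>) \<Psi> = r * dual_app (wedge22 \<alpha> \<beta>) \<Psi>"
  "dual_app (wedge22 \<alpha> (r *\<^sub>R \<beta>)) \<Psi> = r * dual_app (wedge22 \<alpha> \<beta>) \<Psi>"
  by (simp_all add: wedge22.rep_eq dual_rep_simps dual_app_simps linear_add[OF linear_contract]
      linear_cmul[OF linear_contract])

lemma span_singleton_scale: "k \<noteq> 0 \<Longrightarrow> span {k *\<^sub>R x} = span {x :: 'a::real_vector}"
proof (rule antisym; rule span_minimal)
  assume "k \<noteq> 0"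
  then have "x = (1 / k) *\<^sub>R (k *\<^sub>R x)" by simp
  then show "{x} \<subseteq> span {k *\<^sub>R x}" by (metis bot.extremum insert_subset singletonI span_base span_scale)
qed (auto simp: span_scale span_base)

lemma span_singletonD: "x \<in> span {y :: 'a::real_vector} \<Longrightarrow> \<exists>k. x = k *\<^sub>R y"
  by (auto simp: span_singleton)

text \<open>With \<open>p\<close> as pivot the factors can be taken in reduced form, without
  \<open>f\<close> in the first and without \<open>e\<close> in the second. This matches five
  coefficients at once, and the relation forces the sixth, \<open>u\<close>.\<close>

lemma plucker_relation_decomposable_aux:
  assumes "p \<noteq> 0" "p * u - q * t + r * s = 0"
  shows "\<exists>x y. p *\<^sub>R wedge e f + q *\<^sub>R wedge e g + r *\<^sub>R wedge e h + s *\<^sub>R wedge f g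
      + t *\<^sub>R wedge f h + u *\<^sub>R wedge g h = wedge x y"
proof (intro exI)
  have u: "u = (q * t - r * s) / p" using assms by (simp add: field_simps)
  show "p *\<^sub>R wedge e f + q *\<^sub>R wedge e g + r *\<^sub>R wedge e h + s *\<^sub>R wedge f g
      + t *\<^sub>R wedge f h + u *\<^sub>R wedge g h
    = wedge (p *\<^sub>R e - s *\<^sub>R g - t *\<^sub>R h) (f + (q / p) *\<^sub>R g + (r / p) *\<^sub>R h)"
    using assms(1)
    by (simp add: wedge_simps wedge_swap[of g f] wedge_swap[of h f] wedge_swap[of h g] u
        scaleR_left_diff_distrib algebra_simps diff_divide_distrib)
qed

text \<open>Any nonzero coefficient becomes the pivot after reordering \<open>e\<close>,
  \<open>f\<close>, \<open>g\<close>, \<open>h\<close>; the sign changes come from swapping wedge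
  factors. If there is none, the bivector is zero.\<close>

lemma plucker_relation_decomposable:
  assumes "p * u - q * t + r * s = 0"
  shows "\<exists>x y. p *\<^sub>R wedge e f + q *\<^sub>R wedge e g + r *\<^sub>R wedge e h + s *\<^sub>R wedge f g
      + t *\<^sub>R wedge f h + u *\<^sub>R wedge g h = wedge x y"
proof -
  note sw = wedge_swap[of g f] wedge_swap[of h f] wedge_swap[of h g]
    wedge_swap[of g e] wedge_swap[of h e] wedge_swap[of f e]
  consider "p \<noteq> 0" | "q \<noteq> 0" | "r \<noteq> 0" | "s \<noteq> 0" | "t \<noteq> 0" | "u \<noteq> 0"
    | "p = 0 \<and> q = 0 \<and> r = 0 \<and> s = 0 \<and> t = 0 \<and> u = 0" by blast
  then show ?thesis
  proof cases
    case 1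
    then show ?thesis using assms by (rule plucker_relation_decomposable_aux)
  next
    case 2
    from plucker_relation_decomposable_aux[of q t p u r "- s" e g f h, OF this]
    show ?thesis using assms by (simp add: sw algebra_simps)
  next
    case 3
    from plucker_relation_decomposable_aux[of r s p "- u" q "- t" e h f g, OF this]
    show ?thesis using assms by (simp add: sw algebra_simps)
  next
    case 4
    from plucker_relation_decomposable_aux[of s r "- p" u t "- q" f g e h, OF this]
    show ?thesis using assms by (simp add: sw algebra_simps)
  next
    case 5
    from plucker_relation_decomposable_aux[of t q "- p" "- u" s "- r" f h e g, OF this]
    show ?thesis using assms by (simp add: sw algebra_simps)
  next
    case 6
    from plucker_relation_decomposable_aux[of u p "- q" "- t" "- s" "- r" g h e f, OF this]
    show ?thesis using assms by (simp add: sw algebra_simps)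
  next
    case 7
    then show ?thesis by (metis add_0 scaleR_zero_left wedge_simps(9))
  qed
qed

lemma independent_pair_if_wedge_neq_0:
  assumes "wedge u v \<noteq> 0"
  shows "independent {u, v}" "u \<noteq> v"
proof -
  show "u \<noteq> v" using assms by (auto simp: wedge_simps)
  have "v \<noteq> 0" using assms by (auto simp: wedge_simps)
  moreover have "u \<notin> span {v}" using assms span_singletonD[of u v] by (auto simp: wedge_simps)
  ultimately show "independent {u, v}" using \<open>u \<noteq> v\<close> by (simp add: independent_insert)
qed

lemma image_Collect_binary: "f ` {g a b | a b. P a b} = {f (g a b) | a b. P a b}"
  by blast

section \<open>Symplectic bases of a four-dimensional space\<close>

locale symplectic4 =
  fixes \<omega> :: "'v::real_vector \<Rightarrow> 'v \<Rightarrow> real"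
  assumes dim4: "dim (UNIV :: 'v set) = 4" and symplectic: "symplectic_form \<omega>"
begin

lemma omega_alternating: "alternating2 \<omega>"
  using symplectic by (simp add: symplectic_form_def)

lemmas omega_simps = alternating2_simps[OF omega_alternating]
lemmas omega_swap = alternating2_swap[OF omega_alternating]

lemma omega_nondegenerate: "(\<And>v. \<omega> u v = 0) \<Longrightarrow> u = 0"
  using symplectic by (simp add: symplectic_form_def)

lemma alt2_app_Alt2_omega: "alt2_app (Alt2 \<omega>) = \<omega>"
  using omega_alternating by (simp add: Alt2_inverse)

lemma independent4_spans:
  assumes "independent (A :: 'v set)" "card A = 4"
  shows "span A = UNIV"
proof (rule ccontr)
  assume "span A \<noteq> UNIV"
  then obtain x where x: "x \<notin> span A" by blast
  obtain B :: "'v set" where B: "independent B" "span B = UNIV" "card B = 4"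
    using basis_exists[of "UNIV :: 'v set"] dim4 by (metis top.extremum_uniqueI)
  \<comment> \<open>The cardinality of an infinite set is 0 by convention, so the value 4 makes
    \<open>B\<close> finite.\<close>
  then have fin: "finite B" using card.infinite by fastforce
  have "independent (insert x A)" "x \<notin> A"
    using x assms by (auto simp: independent_insert span_base)
  then have "finite (insert x A)" "card (insert x A) \<le> card B"
    using independent_span_bound[OF fin, of "insert x A"] B by auto
  then show False using \<open>x \<notin> A\<close> assms B by simp
qed

lemma exists_notin_span3: "\<exists>x. x \<notin> span {a, b, c :: 'v}"
proof (rule ccontr)
  assume "\<nexists>x. x \<notin> span {a, b, c}"
  then have "dim (UNIV :: 'v set) \<le> card {a, b, c}"
    by (intro dim_le_card) auto
  also have "\<dots> \<le> 3" by (metis card_length list.size(3,4) list.set numeral_3_eq_3 One_nat_def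
        add_0 plus_1_eq_Suc add.commute)
  finally show False using dim4 by simp
qed

abbreviation symplectic_basis where
  "symplectic_basis e f g h \<equiv> \<omega> e f = 1 \<and> \<omega> g h = 1 \<and> \<omega> e g = 0 \<and> \<omega> e h = 0 \<and> \<omega> f g = 0 \<and> \<omega> f h = 0"

lemma form_wedge_app:
  "alt4_app (form_wedge (Alt2 \<omega>) (Alt2 \<omega>)) a b c d
    = 2 * (\<omega> a b * \<omega> c d - \<omega> a c * \<omega> b d + \<omega> a d * \<omega> b c)"
  by (simp add: form_wedge.rep_eq alt2_app_Alt2_omega)

lemma symplectic_basis_span:
  assumes "symplectic_basis e f g h"
  shows "span {e, f, g, h} = UNIV"
proof -
  \<comment> \<open>The value is 2, and a nonzero value makes the four vectors independent.\<close>
  have "alt4_app (form_wedge (Alt2 \<omega>) (Alt2 \<omega>)) e f g h \<noteq> 0"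
    using assms by (simp add: form_wedge_app)
  from independent_if_alternating4_neq_0[OF alternating4_alt4_app this]
  show ?thesis by (rule independent4_spans)
qed

lemma symplectic_basis_extend:
  assumes "\<omega> e f = 1"
  shows "\<exists>g h. symplectic_basis e f g h"
proof -
  \<comment> \<open>The projection along the plane of \<open>e\<close> and \<open>f\<close> onto its
    symplectic complement.\<close>
  define pr where "pr x = x - \<omega> x f *\<^sub>R e - \<omega> e x *\<^sub>R f" for x
  have fe: "\<omega> f e = - 1" using assms omega_swap[of e f] by simp
  have pr: "\<omega> e (pr x) = 0" "\<omega> f (pr x) = 0" for x
    using assms fe omega_swap[of f x] by (simp_all add: pr_def omega_simps)
  obtain x where x: "x \<notin> span {e, f}" using exists_notin_span3[of e f f] by auto
  have "pr x \<noteq> 0"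
  proof
    assume "pr x = 0"
    then have "x = \<omega> x f *\<^sub>R e + \<omega> e x *\<^sub>R f" by (simp add: pr_def algebra_simps)
    then show False using x span_pair by blast
  qed
  then obtain y where y: "\<omega> (pr x) y \<noteq> 0" using omega_nondegenerate by blast
  \<comment> \<open>Since \<open>pr x\<close> is orthogonal to \<open>e\<close> and
    \<open>f\<close>, replacing \<open>y\<close> by \<open>pr y\<close> keeps the pairing, which is
    then scaled to 1.\<close>
  have "\<omega> (pr x) (pr y) = \<omega> (pr x) y"
    using pr[of x] omega_swap[of _ "pr x"] by (simp add: pr_def[of y] omega_simps)
  then have "symplectic_basis e f (pr x) ((1 / \<omega> (pr x) y) *\<^sub>R pr y)"
    using assms pr y by (simp add: omega_simps)
  then show ?thesis by blast
qed

lemma symplectic_basis_exists: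
  obtains e f g h where "symplectic_basis e f g h"
proof -
  obtain x :: 'v where "x \<noteq> 0" using exists_notin_span3[of 0 0 0] by auto
  then obtain y where "\<omega> x y \<noteq> 0" using omega_nondegenerate by blast
  then have "\<omega> x ((1 / \<omega> x y) *\<^sub>R y) = 1" by (simp add: omega_simps)
  then show ?thesis using symplectic_basis_extend that by blast
qed

text \<open>The difference of the two sides pairs to zero with each basis vector, hence with
  everything, and nondegeneracy makes it zero.\<close>

lemma symplectic_basis_expand:
  assumes "symplectic_basis e f g h"
  shows "x = \<omega> x f *\<^sub>R e + \<omega> e x *\<^sub>R f + \<omega> x h *\<^sub>R g + \<omega> g x *\<^sub>R h"
proof -
  let ?y = "x - (\<omega> x f *\<^sub>R e + \<omega> e x *\<^sub>R f + \<omega> x h *\<^sub>R g + \<omega> g x *\<^sub>R h)"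
  have *: "\<omega> ?y b = 0" if "b \<in> {e, f, g, h}" for b
    using that assms omega_swap[of e f] omega_swap[of g h] omega_swap[of f g] omega_swap[of f h]
      omega_swap[of e g] omega_swap[of e h] omega_swap[of e x] omega_swap[of g x] by (auto simp: omega_simps)
  have "linear (\<omega> ?y)" by (rule linearI) (simp_all add: omega_simps)
  then have "\<omega> ?y v = 0" for v
    by (rule linear_eq_0_if_spanning[OF _ _ symplectic_basis_span[OF assms]]) (rule *)
  then have "?y = 0" by (rule omega_nondegenerate)
  then show ?thesis by simp
qed

section \<open>The volume element and the form \<open>dot\<close>\<close>

text \<open>A 4-form is determined by its value on one symplectic basis, so
  \<open>\<omega> \<and> \<omega>\<close> spans all 4-forms and a functional on them is known from
  its value there.\<close>

lemma ext4_eqI: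
  assumes "dual_app \<sigma> (form_wedge (Alt2 \<omega>) (Alt2 \<omega>)) = dual_app \<tau> (form_wedge (Alt2 \<omega>) (Alt2 \<omega>))"
  shows "\<sigma> = \<tau>"
proof (rule dual_eqI)
  fix \<Psi> :: "'v alt4"
  let ?O = "form_wedge (Alt2 \<omega>) (Alt2 \<omega>)"
  obtain e f g h where b: "symplectic_basis e f g h" by (rule symplectic_basis_exists)
  \<comment> \<open>The half compensates for the value 2 of \<open>\<omega> \<and> \<omega>\<close>
    on a symplectic basis.\<close>
  define c where "c = alt4_app \<Psi> e f g h / 2"
  have "alt4_app (\<Psi> - c *\<^sub>R ?O) e f g h = 0"
    using b by (simp add: minus_alt4.rep_eq scaleR_alt4.rep_eq form_wedge_app c_def)
  from alternating4_eq_0[OF alternating4_alt4_app symplectic_basis_span[OF b] this]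
  have "\<Psi> - c *\<^sub>R ?O = 0" by (intro alt4_eqI) (simp add: zero_alt4.rep_eq)
  then have "\<Psi> = c *\<^sub>R ?O" by simp
  then show "dual_app \<sigma> \<Psi> = dual_app \<tau> \<Psi>" using assms by (simp add: dual_app_simps)
qed

lemma dual_app_vol: "dual_app (vol \<omega>) (form_wedge (Alt2 \<omega>) (Alt2 \<omega>)) = -2"
proof -
  obtain e f g h where b: "symplectic_basis e f g h" by (rule symplectic_basis_exists)
  have "dual_app (- wedge4 e f g h) (form_wedge (Alt2 \<omega>) (Alt2 \<omega>)) = -2"
    using b by (simp add: dual_rep_simps wedge4.rep_eq form_wedge_app)
  then have "\<exists>!\<tau>. dual_app \<tau> (form_wedge (Alt2 \<omega>) (Alt2 \<omega>)) = -2"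
    using ext4_eqI by metis
  then show ?thesis unfolding vol_def by (rule theI')
qed

text \<open>Evaluation on \<open>\<omega> \<and> \<omega>\<close> is injective on 4-vectors and
  takes \<open>vol \<omega>\<close> to -2, which resolves the \<open>THE\<close>.\<close>

lemma dot_eq: "dot \<omega> \<alpha> \<beta> = - dual_app (wedge22 \<alpha> \<beta>) (form_wedge (Alt2 \<omega>) (Alt2 \<omega>)) / 2"
  unfolding dot_def
proof (rule the_equality)
  show "wedge22 \<alpha> \<beta> = (- dual_app (wedge22 \<alpha> \<beta>) (form_wedge (Alt2 \<omega>) (Alt2 \<omega>)) / 2) *\<^sub>R vol \<omega>"
    by (rule ext4_eqI) (simp add: dual_rep_simps dual_app_vol)
qed (simp add: dual_rep_simps dual_app_vol)

lemma dot_linear: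
  "dot \<omega> (\<alpha> + \<alpha>') \<beta> = dot \<omega> \<alpha> \<beta> + dot \<omega> \<alpha>' \<beta>"
  "dot \<omega> \<alpha> (\<beta> + \<beta>') = dot \<omega> \<alpha> \<beta> + dot \<omega> \<alpha> \<beta>'"
  "dot \<omega> (r *\<^sub>R \<alpha>) \<beta> = r * dot \<omega> \<alpha> \<beta>"
  "dot \<omega> \<alpha> (r *\<^sub>R \<beta>) = r * dot \<omega> \<alpha> \<beta>"
  by (simp_all add: dot_eq wedge22_bilinear add_divide_distrib)

lemma dot_neg:
  "dot \<omega> (- \<alpha>) \<beta> = - dot \<omega> \<alpha> \<beta>" "dot \<omega> \<alpha> (- \<beta>) = - dot \<omega> \<alpha> \<beta>"
  "dot \<omega> (\<alpha> - \<alpha>') \<beta> = dot \<omega> \<alpha> \<beta> - dot \<omega> \<alpha>' \<beta>"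
  "dot \<omega> \<alpha> (\<beta> - \<beta>') = dot \<omega> \<alpha> \<beta> - dot \<omega> \<alpha> \<beta>'"
  using dot_linear(3)[of "-1" \<alpha> \<beta>] dot_linear(4)[of \<alpha> "-1" \<beta>]
    dot_linear(1)[of "\<alpha> - \<alpha>'" \<alpha>' \<beta>] dot_linear(2)[of \<alpha> "\<beta> - \<beta>'" \<beta>'] by simp_all

lemmas dot_simps = dot_linear dot_neg

lemma dot_wedge: "dot \<omega> (wedge a b) (wedge c d) = - (\<omega> a b * \<omega> c d - \<omega> a c * \<omega> b d + \<omega> a d * \<omega> b c)"
  by (simp add: dot_eq wedge22_wedge wedge4.rep_eq form_wedge_app)

text \<open>A 4-form vanishing on a spanning quadruple is zero, which
  \<open>\<omega> \<and> \<omega>\<close> is not; conversely, a nonzero value makes the quadruple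
  independent.\<close>

lemma dot_wedge_eq_0_iff: "dot \<omega> (wedge a b) (wedge c d) = 0 \<longleftrightarrow> span {a, b, c, d} \<noteq> UNIV"
proof -
  let ?O = "form_wedge (Alt2 \<omega>) (Alt2 \<omega>)"
  have eq: "dot \<omega> (wedge a b) (wedge c d) = - alt4_app ?O a b c d / 2"
    by (simp add: dot_eq wedge22_wedge wedge4.rep_eq)
  have "span {a, b, c, d} \<noteq> UNIV" if 0: "alt4_app ?O a b c d = 0"
  proof
    assume "span {a, b, c, d} = UNIV"
    from alternating4_eq_0[OF alternating4_alt4_app this 0]
    have "alt4_app ?O w x y z = 0" for w x y z .
    moreover obtain e f g h where "symplectic_basis e f g h" by (rule symplectic_basis_exists)
    ultimately show False using form_wedge_app[of e f g h] by simp
  qed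
  moreover have "span {a, b, c, d} = UNIV" if "alt4_app ?O a b c d \<noteq> 0"
    using independent4_spans independent_if_alternating4_neq_0[OF alternating4_alt4_app that] by blast
  ultimately show ?thesis using eq by auto
qed

section \<open>Coordinates of bivectors and the vector \<open>omega_star\<close>\<close>

text \<open>For \<open>p, q\<close> in a symplectic basis these forms are, up to sign, the basis dual to the
  bivectors of that basis.\<close>

lift_definition covec :: "'v \<Rightarrow> 'v \<Rightarrow> 'v alt2" is "\<lambda>p q x y. \<omega> p x * \<omega> q y - \<omega> p y * \<omega> q x"
  by (auto simp: alternating2_def bilinear_def omega_simps algebra_simps intro!: linearI)

lemma symplectic_basis_values:
  assumes "symplectic_basis e f g h"
  shows "\<omega> e f = 1" "\<omega> f e = -1" "\<omega> g h = 1" "\<omega> h g = -1" "\<omega> e g = 0" "\<omega> g e = 0" "\<omega> e h = 0"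
    "\<omega> h e = 0" "\<omega> f g = 0" "\<omega> g f = 0" "\<omega> f h = 0" "\<omega> h f = 0"
  using assms omega_swap[of f e] omega_swap[of h g] omega_swap[of g e] omega_swap[of h e] omega_swap[of g f]
    omega_swap[of h f] by auto

text \<open>Bivectors are functionals on 2-forms, so it is enough to apply \<open>\<alpha>\<close>
  to the expansion of an arbitrary form in the \<open>covec\<close> forms.\<close>

lemma bivector_expand:
  assumes "symplectic_basis e f g h"
  shows "\<exists>p q r s t u. \<alpha> = p *\<^sub>R wedge e f + q *\<^sub>R wedge e g + r *\<^sub>R wedge e h + s *\<^sub>R wedge f g
      + t *\<^sub>R wedge f h + u *\<^sub>R wedge g h"
proof -
  \<comment> \<open>The coefficients are the values of the form on pairs of basis vectors; the signs
    are those relating \<open>covec\<close> to the dual basis.\<close>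
  have \<phi>: "\<phi> = alt2_app \<phi> e f *\<^sub>R covec e f + alt2_app \<phi> e g *\<^sub>R covec f h - alt2_app \<phi> e h *\<^sub>R covec f g
      - alt2_app \<phi> f g *\<^sub>R covec e h + alt2_app \<phi> f h *\<^sub>R covec e g + alt2_app \<phi> g h *\<^sub>R covec g h" for \<phi>
  proof (rule alt2_eqI)
    fix x y
    note arg_cong2[OF symplectic_basis_expand[OF assms, of x] symplectic_basis_expand[OF assms, of y],
      of "alt2_app \<phi>"]
    then show "alt2_app \<phi> x y = alt2_app (alt2_app \<phi> e f *\<^sub>R covec e f + alt2_app \<phi> e g *\<^sub>R covec f h
      - alt2_app \<phi> e h *\<^sub>R covec f g - alt2_app \<phi> f g *\<^sub>R covec e h + alt2_app \<phi> f h *\<^sub>R covec e g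
      + alt2_app \<phi> g h *\<^sub>R covec g h) x y"
      by (simp add: alt2_app_simps alt2_app_swap[of \<phi> f e] alt2_app_swap[of \<phi> h g]
        alt2_app_swap[of \<phi> g e] alt2_app_swap[of \<phi> h e] alt2_app_swap[of \<phi> g f]
        alt2_app_swap[of \<phi> h f] plus_alt2.rep_eq minus_alt2.rep_eq scaleR_alt2.rep_eq covec.rep_eq
        omega_swap[of x f] omega_swap[of x h] omega_swap[of y f] omega_swap[of y h] algebra_simps)
  qed
  have "\<alpha> = dual_app \<alpha> (covec e f) *\<^sub>R wedge e f + dual_app \<alpha> (covec f h) *\<^sub>R wedge e g
    + (- dual_app \<alpha> (covec f g)) *\<^sub>R wedge e h + (- dual_app \<alpha> (covec e h)) *\<^sub>R wedge f g
    + dual_app \<alpha> (covec e g) *\<^sub>R wedge f h + dual_app \<alpha> (covec g h) *\<^sub>R wedge g h"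
  proof (rule dual_eqI)
    fix \<phi> :: "'v alt2"
    show "dual_app \<alpha> \<phi> = dual_app (dual_app \<alpha> (covec e f) *\<^sub>R wedge e f
      + dual_app \<alpha> (covec f h) *\<^sub>R wedge e g
    + (- dual_app \<alpha> (covec f g)) *\<^sub>R wedge e h + (- dual_app \<alpha> (covec e h)) *\<^sub>R wedge f g
    + dual_app \<alpha> (covec e g) *\<^sub>R wedge f h + dual_app \<alpha> (covec g h) *\<^sub>R wedge g h) \<phi>"
      by (subst \<phi>[of \<phi>]) (simp add: dual_app_simps dual_rep_simps wedge.rep_eq)
  qed
  then show ?thesis by blast
qed

text \<open>Pairing with the complementary basis bivector isolates each of the six coordinates; thus
  \<open>dot\<close> is nondegenerate.\<close>

lemma dot_eq_0D:
  assumes "\<And>u v. dot \<omega> \<alpha> (wedge u v) = 0"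
  shows "\<alpha> = 0"
proof -
  obtain e f g h where b: "symplectic_basis e f g h" by (rule symplectic_basis_exists)
  obtain p q r s t u where "\<alpha> = p *\<^sub>R wedge e f + q *\<^sub>R wedge e g + r *\<^sub>R wedge e h + s *\<^sub>R wedge f g
      + t *\<^sub>R wedge f h + u *\<^sub>R wedge g h"
    using bivector_expand[OF b] by blast
  then show ?thesis
    using assms[of e f] assms[of e g] assms[of e h] assms[of f g] assms[of f h] assms[of g h]
    by (simp add: dot_simps dot_wedge symplectic_basis_values[OF b] omega_simps)
qed

lemma omega_expand:
  assumes "symplectic_basis e f g h"
  shows "\<omega> u v = \<omega> e u * \<omega> f v - \<omega> f u * \<omega> e v + \<omega> g u * \<omega> h v - \<omega> h u * \<omega> g v"
  using arg_cong2[OF symplectic_basis_expand[OF assms, of u] symplectic_basis_expand[OF assms, of v], of \<omega>]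
  by (simp add: omega_simps symplectic_basis_values[OF assms] omega_swap[of u f] omega_swap[of u h] omega_swap[of v f]
      omega_swap[of v h])

text \<open>The defining equation is checked in the basis; uniqueness for the \<open>THE\<close> is
  the nondegeneracy of \<open>dot\<close>.\<close>

lemma omega_star_eq:
  assumes "symplectic_basis e f g h"
  shows "omega_star \<omega> = - wedge e f - wedge g h"
  unfolding omega_star_def
proof (rule the_equality; (intro allI)?)
  show *: "dot \<omega> (- wedge e f - wedge g h) (wedge u v) = \<omega> u v" for u v
    using omega_expand[OF assms, of u v]
    by (simp add: dot_simps dot_wedge symplectic_basis_values[OF assms])
  fix \<alpha> assume "\<forall>u v. dot \<omega> \<alpha> (wedge u v) = \<omega> u v"
  then have "dot \<omega> (\<alpha> - (- wedge e f - wedge g h)) (wedge u v) = 0" for u v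
    using * by (simp add: dot_neg)
  from dot_eq_0D[OF this] show "\<alpha> = - wedge e f - wedge g h" by simp
qed

lemma form_eval_simps:
  "form_eval \<omega> (\<alpha> + \<beta>) = form_eval \<omega> \<alpha> + form_eval \<omega> \<beta>"
  "form_eval \<omega> (\<alpha> - \<beta>) = form_eval \<omega> \<alpha> - form_eval \<omega> \<beta>"
  "form_eval \<omega> (- \<alpha>) = - form_eval \<omega> \<alpha>"
  "form_eval \<omega> (r *\<^sub>R \<alpha>) = r * form_eval \<omega> \<alpha>"
  "form_eval \<omega> (wedge u v) = \<omega> u v"
  by (simp_all add: form_eval_def dual_rep_simps wedge.rep_eq alt2_app_Alt2_omega)

text \<open>In coordinates, the defining property of \<open>omega_star\<close> passes from
  decomposable bivectors to all, in either slot; hence \<open>W \<omega>\<close> is its orthogonal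
  complement.\<close>

lemma dot_omega_star: "dot \<omega> (omega_star \<omega>) \<alpha> = form_eval \<omega> \<alpha>" "dot \<omega> \<alpha> (omega_star \<omega>) = form_eval \<omega> \<alpha>"
proof -
  obtain e f g h where b: "symplectic_basis e f g h" by (rule symplectic_basis_exists)
  obtain p q r s t u where "\<alpha> = p *\<^sub>R wedge e f + q *\<^sub>R wedge e g + r *\<^sub>R wedge e h + s *\<^sub>R wedge f g
      + t *\<^sub>R wedge f h + u *\<^sub>R wedge g h"
    using bivector_expand[OF b] by blast
  then show "dot \<omega> (omega_star \<omega>) \<alpha> = form_eval \<omega> \<alpha>" "dot \<omega> \<alpha> (omega_star \<omega>) = form_eval \<omega> \<alpha>"
    by (simp_all add: omega_star_eq[OF b] dot_simps dot_wedge symplectic_basis_values[OF b] omega_simps form_eval_simps)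
qed

lemma form_eval_omega_star: "form_eval \<omega> (omega_star \<omega>) = -2"
proof -
  obtain e f g h where b: "symplectic_basis e f g h" by (rule symplectic_basis_exists)
  then show ?thesis by (simp add: omega_star_eq[OF b] form_eval_simps)
qed

section \<open>Planes and null bivectors\<close>

text \<open>In a symplectic basis \<open>dot \<omega> \<alpha> \<alpha>\<close> is -2 times the left
  side of the Pluecker relation.\<close>

lemma null_decomposable:
  assumes "dot \<omega> \<alpha> \<alpha> = 0"
  shows "\<exists>u v. \<alpha> = wedge u v"
proof -
  obtain e f g h where b: "symplectic_basis e f g h" by (rule symplectic_basis_exists)
  obtain p q r s t u where \<alpha>: "\<alpha> = p *\<^sub>R wedge e f + q *\<^sub>R wedge e g + r *\<^sub>R wedge e h + s *\<^sub>R wedge f g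
      + t *\<^sub>R wedge f h + u *\<^sub>R wedge g h"
    using bivector_expand[OF b] by blast
  have "dot \<omega> \<alpha> \<alpha> = - 2 * (p * u - q * t + r * s)"
    unfolding \<alpha> by (simp add: dot_simps dot_wedge symplectic_basis_values[OF b] omega_simps algebra_simps)
  then have "p * u - q * t + r * s = 0" using assms by simp
  from plucker_relation_decomposable[OF this] show ?thesis unfolding \<alpha> by metis
qed

lemma dot_wedge_self: "dot \<omega> (wedge u v) (wedge u v) = 0"
  using omega_swap[of v u] by (simp add: dot_wedge omega_simps)

lemma complete_to_spanning:
  assumes "independent {a, b}" "a \<noteq> b" "c \<notin> span {a, b}"
  shows "\<exists>d. span {a, b, c, d :: 'v} = UNIV"
proof -
  obtain d where d: "d \<notin> span {a, b, c}" using exists_notin_span3 by blast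
  have c: "independent {c, a, b}" using assms by (simp add: independent_insert)
  have "{c, a, b} = {a, b, c}" by auto
  then have "independent {d, a, b, c}" using d c by (simp add: independent_insert)
  moreover have "card {d, a, b, c} = 4"
  proof -
    have "c \<noteq> a" "c \<noteq> b" "d \<noteq> a" "d \<noteq> b" "d \<noteq> c" using assms d by (auto simp: span_base)
    then show ?thesis using assms(2) by simp
  qed
  ultimately have "span {d, a, b, c} = UNIV" by (rule independent4_spans)
  moreover have "{d, a, b, c} = {a, b, c, d}" by auto
  ultimately show ?thesis by metis
qed

lemma wedge_neq_0:
  assumes "independent {u, v :: 'v}" "u \<noteq> v"
  shows "wedge u v \<noteq> 0"
proof
  assume 0: "wedge u v = 0"
  obtain c where "c \<notin> span {u, v}" using exists_notin_span3[of u v v] by auto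
  then obtain d where "span {u, v, c, d} = UNIV" using complete_to_spanning assms by blast
  then have "dot \<omega> (wedge u v) (wedge c d) \<noteq> 0" using dot_wedge_eq_0_iff by blast
  then show False using 0 dot_linear(3)[of 0 0] by simp
qed

lemma Gr2_iff: "S \<in> Gr2 \<longleftrightarrow> (\<exists>u v :: 'v. S = span {u, v} \<and> wedge u v \<noteq> 0)"
proof
  assume "S \<in> Gr2"
  then have S: "subspace S" "dim S = 2" by (auto simp: Gr2_def)
  obtain B where B: "B \<subseteq> S" "independent B" "S \<subseteq> span B" "card B = dim S"
    using basis_exists by blast
  then obtain u v where uv: "B = {u, v}" "u \<noteq> v" using S by (metis card_2_iff)
  have "span B = S" using B S by (simp add: span_minimal subset_antisym)
  then show "\<exists>u v. S = span {u, v} \<and> wedge u v \<noteq> 0" using uv wedge_neq_0[of u v] B(2) by metis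
next
  assume "\<exists>u v :: 'v. S = span {u, v} \<and> wedge u v \<noteq> 0"
  then obtain u v where S: "S = span {u, v}" and w: "wedge u v \<noteq> 0" by blast
  note i = independent_pair_if_wedge_neq_0[OF w]
  then show "S \<in> Gr2" by (simp add: Gr2_def S dim_eq_card_independent)
qed

text \<open>Recovers a plane from its bivector: a vector \<open>x\<close> outside the plane can be
  completed by some \<open>y\<close> to a spanning quadruple, which gives a nonzero product.\<close>

lemma mem_span_iff_dot:
  assumes "wedge u v \<noteq> 0"
  shows "x \<in> span {u, v} \<longleftrightarrow> (\<forall>y. dot \<omega> (wedge u v) (wedge x y) = 0)"
proof
  assume "x \<in> span {u, v}"
  then obtain a b where "x = a *\<^sub>R u + b *\<^sub>R v" by (auto simp: span_pair)
  then show "\<forall>y. dot \<omega> (wedge u v) (wedge x y) = 0"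
    using omega_swap[of v u] by (simp add: dot_wedge omega_simps algebra_simps)
next
  assume 0: "\<forall>y. dot \<omega> (wedge u v) (wedge x y) = 0"
  show "x \<in> span {u, v}"
  proof (rule ccontr)
    assume "x \<notin> span {u, v}"
    with independent_pair_if_wedge_neq_0[OF assms]
    obtain y where "span {u, v, x, y} = UNIV" using complete_to_spanning by blast
    then show False using 0 dot_wedge_eq_0_iff by blast
  qed
qed

text \<open>The membership test by vanishing products ignores a nonzero scalar, so the Pluecker map
  is injective on planes.\<close>

lemma span_eq_if_wedge_eq_scale:
  assumes "wedge u v = k *\<^sub>R wedge u' (v' :: 'v)" "wedge u v \<noteq> 0"
  shows "span {u, v} = span {u', v'}"
proof -
  have "k \<noteq> 0" "wedge u' v' \<noteq> 0" using assms by auto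
  then show ?thesis
    using mem_span_iff_dot[OF assms(2)] mem_span_iff_dot[of u' v']
    by (auto simp: assms(1) dot_simps)
qed

lemma transverse_span_iff:
  "transverse (span {a, b}) (span {c, d}) \<longleftrightarrow> dot \<omega> (wedge a b) (wedge c d) \<noteq> 0"
proof -
  have "{x + y |x y. x \<in> span {a, b} \<and> y \<in> span {c, d}} = span ({a, b} \<union> {c, d})"
    by (simp only: span_Un)
  also have "{a, b} \<union> {c, d} = {a, b, c, d}" by auto
  finally show ?thesis by (simp add: transverse_def dot_wedge_eq_0_iff)
qed

lemma wedge_neq_0_if_omega: "\<omega> u v \<noteq> 0 \<Longrightarrow> wedge u v \<noteq> 0"
  using form_eval_simps(5)[of u v] form_eval_simps(4)[of 0 0] by auto

section \<open>Nondegenerate planes and the map \<open>mu\<close>\<close>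

lemma nondegenerate_plane_iff:
  "nondegenerate_plane \<omega> S \<longleftrightarrow> (\<exists>u v. S = span {u, v} \<and> \<omega> u v = 1)"
proof
  assume S: "nondegenerate_plane \<omega> S"
  then obtain u v where uv: "S = span {u, v}" "wedge u v \<noteq> 0"
    by (auto simp: nondegenerate_plane_def Gr2_iff)
  \<comment> \<open>Otherwise \<open>u\<close> would be orthogonal to the whole plane.\<close>
  have "\<omega> u v \<noteq> 0"
  proof
    assume "\<omega> u v = 0"
    then have "\<forall>y\<in>S. \<omega> u y = 0" by (auto simp: uv(1) span_pair omega_simps)
    then have "u = 0" using S by (auto simp: nondegenerate_plane_def uv(1) span_base)
    then show False using uv(2) by (simp add: wedge_simps)
  qed
  define w where "w = (1 / \<omega> u v) *\<^sub>R v"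
  have "wedge u v = \<omega> u v *\<^sub>R wedge u w" using \<open>\<omega> u v \<noteq> 0\<close> by (simp add: w_def wedge_simps)
  then have "S = span {u, w}" using span_eq_if_wedge_eq_scale uv by blast
  moreover have "\<omega> u w = 1" using \<open>\<omega> u v \<noteq> 0\<close> by (simp add: w_def omega_simps)
  ultimately show "\<exists>u v. S = span {u, v} \<and> \<omega> u v = 1" by blast
next
  assume "\<exists>u v. S = span {u, v} \<and> \<omega> u v = 1"
  then obtain u v where uv: "S = span {u, v}" "\<omega> u v = 1" by blast
  have "x = 0" if x_mem: "x \<in> S" and orth: "\<forall>y\<in>S. \<omega> x y = 0" for x
  proof -
    obtain a b where x: "x = a *\<^sub>R u + b *\<^sub>R v" using x_mem unfolding uv(1) span_pair by blast
    have "\<omega> x u = 0" "\<omega> x v = 0" using orth by (auto simp: uv(1) span_base)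
    then show ?thesis using uv(2) omega_swap[of v u] by (simp add: x omega_simps)
  qed
  moreover have "S \<in> Gr2" using uv wedge_neq_0_if_omega[of u v] by (auto simp: Gr2_iff)
  ultimately show "nondegenerate_plane \<omega> S" by (auto simp: nondegenerate_plane_def)
qed

lemma symp_orth_span:
  assumes "symplectic_basis e f g h"
  shows "symp_orth \<omega> (span {e, f}) = span {g, h}"
proof (intro set_eqI iffI)
  note v = symplectic_basis_values[OF assms]
  fix x
  {
    assume "x \<in> symp_orth \<omega> (span {e, f})"
    then have "\<omega> x e = 0" "\<omega> x f = 0" by (auto simp: symp_orth_def span_base)
    then have "x = \<omega> x h *\<^sub>R g + \<omega> g x *\<^sub>R h"
      using symplectic_basis_expand[OF assms, of x] omega_swap[of e x] by simp
    then show "x \<in> span {g, h}" unfolding span_pair by blast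
  next
    assume "x \<in> span {g, h}"
    then show "x \<in> symp_orth \<omega> (span {e, f})"
      by (auto simp: symp_orth_def span_pair omega_simps v)
  }
qed

text \<open>The projection to \<open>W \<omega>\<close> is linear in the representative, so all
  nonzero multiples of \<open>wedge u v\<close> give the same line.\<close>

lemma mu_span:
  assumes "\<omega> u v = 1"
  shows "mu \<omega> (span {u, v}) = span {wedge u v + (1 / 2) *\<^sub>R omega_star \<omega>}"
proof -
  let ?s = "wedge u v + (1 / 2) *\<^sub>R omega_star \<omega>"
  have w: "wedge u v \<noteq> 0" using assms wedge_neq_0_if_omega by simp
  have *: "span {\<sigma> + (form_eval \<omega> \<sigma> / 2) *\<^sub>R omega_star \<omega>} = span {?s}"
    if \<sigma>: "\<sigma> \<in> span {wedge u v} - {0}" for \<sigma>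
  proof -
    obtain k where k: "\<sigma> = k *\<^sub>R wedge u v" "k \<noteq> 0" using \<sigma> span_singletonD[of \<sigma> "wedge u v"] by auto
    then have "\<sigma> + (form_eval \<omega> \<sigma> / 2) *\<^sub>R omega_star \<omega> = k *\<^sub>R ?s"
      using assms by (simp add: form_eval_simps scaleR_add_right)
    then show ?thesis using span_singleton_scale[OF k(2)] by metis
  qed
  \<comment> \<open>A nonzero representative exists, so the condition in \<open>mu\<close> is not
    vacuous and pins down the line.\<close>
  have "wedge u v \<in> span {wedge u v} - {0}" using w by (simp add: span_base)
  then show ?thesis
    unfolding mu_def plucker_span by (intro the_equality) (use * in blast)+
qed

lemma symplectic_basis_swap:
  assumes "symplectic_basis e f g h"
  shows "symplectic_basis g h e f"
  using symplectic_basis_values[OF assms] by simp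

text \<open>As \<open>omega_star \<omega>\<close> is \<open>- wedge e f - wedge g h\<close>, the two
  projected vectors are opposite. The double complement comes from exchanging the halves of the
  symplectic basis.\<close>

lemma mu_symp_orth:
  assumes "nondegenerate_plane \<omega> S"
  shows "mu \<omega> (symp_orth \<omega> S) = mu \<omega> S" "symp_orth \<omega> (symp_orth \<omega> S) = S"
proof -
  obtain e f where S: "S = span {e, f}" "\<omega> e f = 1"
    using assms nondegenerate_plane_iff by blast
  obtain g h where b: "symplectic_basis e f g h" using symplectic_basis_extend[OF S(2)] by blast
  note b' = symplectic_basis_swap[OF b]
  show "symp_orth \<omega> (symp_orth \<omega> S) = S"
    by (simp add: S(1) symp_orth_span[OF b] symp_orth_span[OF b'])
  have "wedge g h + (1 / 2) *\<^sub>R omega_star \<omega> = (-1) *\<^sub>R (wedge e f + (1 / 2) *\<^sub>R omega_star \<omega>)"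
    by (simp add: omega_star_eq[OF b] algebra_simps flip: scaleR_add_left)
  then have "span {wedge g h + (1 / 2) *\<^sub>R omega_star \<omega>} = span {wedge e f + (1 / 2) *\<^sub>R omega_star \<omega>}"
    using span_singleton_scale[of "-1"] by (metis neg_equal_0_iff_equal zero_neq_one)
  then show "mu \<omega> (symp_orth \<omega> S) = mu \<omega> S"
    using b by (simp add: S(1) symp_orth_span[OF b] mu_span)
qed

text \<open>The contributions are 0 from \<open>wedge u v\<close>, 1/2 from each cross term and -1/2
  from the \<open>omega_star\<close> part.\<close>

lemma mu_vector_norm:
  assumes "\<omega> u v = 1"
  shows "dot \<omega> (wedge u v + (1 / 2) *\<^sub>R omega_star \<omega>) (wedge u v + (1 / 2) *\<^sub>R omega_star \<omega>) = 1 / 2"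
  using assms
  by (simp add: dot_simps dot_wedge_self dot_omega_star form_eval_omega_star form_eval_simps)

lemma mu_inj:
  assumes S: "nondegenerate_plane \<omega> S" and T: "nondegenerate_plane \<omega> T" and eq: "mu \<omega> T = mu \<omega> S"
  shows "T = S \<or> T = symp_orth \<omega> S"
proof -
  obtain e f where ef: "S = span {e, f}" "\<omega> e f = 1" using S nondegenerate_plane_iff by blast
  obtain u v where uv: "T = span {u, v}" "\<omega> u v = 1" using T nondegenerate_plane_iff by blast
  obtain g h where b: "symplectic_basis e f g h" using symplectic_basis_extend[OF ef(2)] by blast
  let ?s = "wedge e f + (1 / 2) *\<^sub>R omega_star \<omega>" and ?t = "wedge u v + (1 / 2) *\<^sub>R omega_star \<omega>"
  have "?t \<in> span {?s}"
    using eq by (simp add: ef uv mu_span) (metis insertI1 span_base)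
  then obtain k where k: "?t = k *\<^sub>R ?s" using span_singletonD by blast
  \<comment> \<open>Both spanning vectors have square 1/2, so the factor is 1 or -1.\<close>
  have "dot \<omega> ?t ?t = k * (k * dot \<omega> ?s ?s)" unfolding k by (simp only: dot_linear(3,4))
  then have "k * k = 1" unfolding mu_vector_norm[OF ef(2)] mu_vector_norm[OF uv(2)] by simp
  then consider "k = 1" | "k = -1" by (metis square_eq_1_iff)
  moreover have w: "wedge u v \<noteq> 0" using wedge_neq_0_if_omega uv(2) by simp
  ultimately show ?thesis
  proof cases
    case 1
    then have "wedge u v = 1 *\<^sub>R wedge e f" using k by simp
    from span_eq_if_wedge_eq_scale[OF this w] show ?thesis by (simp add: ef uv)
  next
    case 2
    \<comment> \<open>With factor -1 the two halves of \<open>omega_star \<omega>\<close> add up,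
      leaving \<open>wedge g h\<close>, the bivector of the complement.\<close>
    then have "wedge u v = - wedge e f - ((1 / 2) *\<^sub>R omega_star \<omega> + (1 / 2) *\<^sub>R omega_star \<omega>)"
      using k by (simp add: algebra_simps)
    also have "\<dots> = - wedge e f - omega_star \<omega>" by (simp flip: scaleR_add_left)
    also have "\<dots> = 1 *\<^sub>R wedge g h" by (simp add: omega_star_eq[OF b])
    finally have "wedge u v = 1 *\<^sub>R wedge g h" .
    from span_eq_if_wedge_eq_scale[OF this w] show ?thesis
      by (simp add: ef uv symp_orth_span[OF b])
  qed
qed

lemma mu_spacelike:
  assumes "nondegenerate_plane \<omega> S"
  shows "mu \<omega> S \<in> spacelike_lines \<omega>"
proof -
  obtain u v where uv: "S = span {u, v}" "\<omega> u v = 1" using assms nondegenerate_plane_iff by blast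
  let ?t = "wedge u v + (1 / 2) *\<^sub>R omega_star \<omega>"
  have "?t \<in> W \<omega>" using uv by (simp add: W_def form_eval_simps form_eval_omega_star)
  moreover have "dot \<omega> ?t ?t > 0" unfolding mu_vector_norm[OF uv(2)] by simp
  ultimately show ?thesis unfolding spacelike_lines_def uv(1) mu_span[OF uv(2)] by blast
qed

lemma mu_surj:
  assumes "l \<in> spacelike_lines \<omega>"
  shows "\<exists>S. nondegenerate_plane \<omega> S \<and> l = mu \<omega> S"
proof -
  obtain s where s: "l = span {s}" "form_eval \<omega> s = 0" "dot \<omega> s s > 0"
    using assms by (auto simp: spacelike_lines_def W_def)
  \<comment> \<open>Scales \<open>s\<close> to square 1/2, the square of the vectors in
    \<open>mu_vector_norm\<close>.\<close>
  define c where "c = 1 / sqrt (2 * dot \<omega> s s)"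
  have c: "c * c * dot \<omega> s s = 1 / 2" "c \<noteq> 0"
    using s(3) by (simp_all add: c_def)
  define \<alpha> where "\<alpha> = c *\<^sub>R s - (1 / 2) *\<^sub>R omega_star \<omega>"
  \<comment> \<open>The cross terms vanish because \<open>s\<close> lies in
    \<open>W \<omega>\<close>, and the squares 1/2 and -1/2 cancel.\<close>
  have "dot \<omega> \<alpha> \<alpha> = 0"
    using c by (simp add: \<alpha>_def dot_simps dot_omega_star form_eval_simps form_eval_omega_star s
        mult.assoc)
  then obtain u v where uv: "\<alpha> = wedge u v" using null_decomposable by blast
  have "form_eval \<omega> \<alpha> = 1" by (simp add: \<alpha>_def form_eval_simps s form_eval_omega_star)
  then have 1: "\<omega> u v = 1" by (simp add: uv form_eval_simps)
  have "mu \<omega> (span {u, v}) = span {\<alpha> + (1 / 2) *\<^sub>R omega_star \<omega>}" by (simp add: mu_span[OF 1] uv)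
  also have "\<alpha> + (1 / 2) *\<^sub>R omega_star \<omega> = c *\<^sub>R s" by (simp add: \<alpha>_def)
  also have "span {c *\<^sub>R s} = l" by (simp add: span_singleton_scale c s)
  finally show ?thesis using nondegenerate_plane_iff 1 by blast
qed

section \<open>Lagrangian planes and Einstein tori\<close>

lemma lagrangian_plane_iff:
  "lagrangian_plane \<omega> L \<longleftrightarrow> (\<exists>a b. L = span {a, b} \<and> wedge a b \<noteq> 0 \<and> \<omega> a b = 0)"
proof
  assume L: "lagrangian_plane \<omega> L"
  then obtain a b where ab: "L = span {a, b}" "wedge a b \<noteq> 0"
    by (auto simp: lagrangian_plane_def Gr2_iff)
  moreover have "\<omega> a b = 0" using L by (auto simp: lagrangian_plane_def ab(1) span_base)
  ultimately show "\<exists>a b. L = span {a, b} \<and> wedge a b \<noteq> 0 \<and> \<omega> a b = 0" by blast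
next
  assume "\<exists>a b. L = span {a, b} \<and> wedge a b \<noteq> 0 \<and> \<omega> a b = 0"
  then obtain a b where "L = span {a, b}" "wedge a b \<noteq> 0" "\<omega> a b = 0" by blast
  then show "lagrangian_plane \<omega> L"
    using omega_swap[of b a] by (auto simp: lagrangian_plane_def Gr2_iff span_pair omega_simps)
qed

text \<open>A null bivector is some \<open>wedge a b\<close>, and lying in \<open>W \<omega>\<close>
  then means \<open>\<omega> a b = 0\<close>; so null lines are the Pluecker points of Lagrangian
  planes.\<close>

lemma torus_of_line_span:
  "torus_of_line \<omega> (span {s})
    = {span {wedge a b} | a b. wedge a b \<noteq> 0 \<and> \<omega> a b = 0 \<and> dot \<omega> (wedge a b) s = 0}" (is "_ = ?R")
proof -
  have orth: "(\<forall>x\<in>span {y}. \<forall>z\<in>span {s}. dot \<omega> x z = 0) \<longleftrightarrow> dot \<omega> y s = 0" for y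
    by (auto simp: span_singleton dot_simps dest: span_singletonD)
  show ?thesis
  proof (intro set_eqI iffI)
    fix n assume n: "n \<in> torus_of_line \<omega> (span {s})"
    then obtain y where y: "n = span {y}" "form_eval \<omega> y = 0" "y \<noteq> 0" "dot \<omega> y y = 0"
      by (auto simp: torus_of_line_def null_lines_def W_def)
    moreover have "dot \<omega> y s = 0" using n by (simp add: torus_of_line_def y(1) orth)
    moreover obtain a b where "y = wedge a b" using null_decomposable y(4) by blast
    ultimately show "n \<in> ?R" by (auto simp: form_eval_simps)
  next
    fix n assume "n \<in> ?R"
    then obtain a b where "n = span {wedge a b}" "wedge a b \<noteq> 0" "\<omega> a b = 0"
      "dot \<omega> (wedge a b) s = 0" by blast
    then show "n \<in> torus_of_line \<omega> (span {s})"
      by (auto simp: torus_of_line_def null_lines_def orth W_def form_eval_simps dot_wedge_self)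
  qed
qed

lemma plucker_torus:
  assumes "nondegenerate_plane \<omega> S"
  shows "plucker ` torus_of_splitting \<omega> S = torus_of_line \<omega> (mu \<omega> S)"
proof -
  obtain u v where uv: "S = span {u, v}" "\<omega> u v = 1" using assms nondegenerate_plane_iff by blast
  have "torus_of_splitting \<omega> S
    = {span {a, b} | a b. wedge a b \<noteq> 0 \<and> \<omega> a b = 0 \<and> dot \<omega> (wedge a b) (wedge u v) = 0}"
    by (auto simp: torus_of_splitting_def lagrangian_plane_iff uv(1) transverse_span_iff) blast
  then have "plucker ` torus_of_splitting \<omega> S = {plucker (span {a, b}) | a b.
      wedge a b \<noteq> 0 \<and> \<omega> a b = 0 \<and> dot \<omega> (wedge a b) (wedge u v) = 0}"
    by (simp only: image_Collect_binary)
  \<comment> \<open>The \<open>omega_star\<close> part of the spanning vector pairs with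
    \<open>wedge a b\<close> to \<open>\<omega> a b / 2\<close>, which is 0 here, so only
    \<open>wedge u v\<close> matters.\<close>
  also have "\<dots> = torus_of_line \<omega> (mu \<omega> S)"
    unfolding uv(1) mu_span[OF uv(2)] torus_of_line_span plucker_span
    by (simp add: dot_simps dot_omega_star form_eval_simps cong: conj_cong)
  finally show ?thesis .
qed

section \<open>Symplectic splittings and spacelike lines\<close>

lemma mu_bij:
  "\<exists>F. (\<forall>S. nondegenerate_plane \<omega> S \<longrightarrow> F {S, symp_orth \<omega> S} = mu \<omega> S) \<and>
       bij_betw F (symplectic_splittings \<omega>) (spacelike_lines \<omega>)"
proof (intro exI conjI allI impI)
  \<comment> \<open>The choice of a member is harmless, since by \<open>mu_symp_orth\<close> both
    give the same line.\<close>
  let ?F = "\<lambda>X. mu \<omega> (SOME S. S \<in> X)"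
  show F: "?F {S, symp_orth \<omega> S} = mu \<omega> S" if "nondegenerate_plane \<omega> S" for S
  proof -
    have "(SOME T. T \<in> {S, symp_orth \<omega> S}) \<in> {S, symp_orth \<omega> S}" by (rule someI[of _ S]) simp
    then show ?thesis using mu_symp_orth(1)[OF that] by auto
  qed
  show "bij_betw ?F (symplectic_splittings \<omega>) (spacelike_lines \<omega>)"
    unfolding bij_betw_def
  proof
    show "inj_on ?F (symplectic_splittings \<omega>)"
    proof (rule inj_onI)
      fix X Y assume "X \<in> symplectic_splittings \<omega>" "Y \<in> symplectic_splittings \<omega>" "?F X = ?F Y"
      then obtain S T where S: "X = {S, symp_orth \<omega> S}" "nondegenerate_plane \<omega> S"
        and T: "Y = {T, symp_orth \<omega> T}" "nondegenerate_plane \<omega> T" and "?F X = ?F Y"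
        by (auto simp: symplectic_splittings_def)
      then have "mu \<omega> T = mu \<omega> S" using F by metis
      with S T have "T = S \<or> T = symp_orth \<omega> S" using mu_inj by blast
      \<comment> \<open>If \<open>T\<close> is the complement of \<open>S\<close>, the complement of
        \<open>T\<close> is \<open>S\<close> again, so the unordered pairs coincide.\<close>
      then show "X = Y" using S T mu_symp_orth(2)[OF S(2)] by auto
    qed
    show "?F ` symplectic_splittings \<omega> = spacelike_lines \<omega>"
    proof (intro subset_antisym subsetI)
      fix l assume "l \<in> ?F ` symplectic_splittings \<omega>"
      then obtain S where "l = ?F {S, symp_orth \<omega> S}" "nondegenerate_plane \<omega> S"
        by (auto simp: symplectic_splittings_def)
      then show "l \<in> spacelike_lines \<omega>" using F mu_spacelike by metis
    next
      fix l assume "l \<in> spacelike_lines \<omega>"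
      then obtain S where S: "nondegenerate_plane \<omega> S" "l = mu \<omega> S" using mu_surj by blast
      then have "l = ?F {S, symp_orth \<omega> S}" using F by metis
      moreover have "{S, symp_orth \<omega> S} \<in> symplectic_splittings \<omega>"
        using S by (auto simp: symplectic_splittings_def)
      ultimately show "l \<in> ?F ` symplectic_splittings \<omega>" by blast
    qed
  qed
qed

end

theorem proposition3:
  fixes \<omega> :: "'v::real_vector \<Rightarrow> 'v \<Rightarrow> real"
  assumes "dim (UNIV :: 'v set) = 4"
    and "symplectic_form \<omega>"
  shows "(\<exists>F. (\<forall>S. nondegenerate_plane \<omega> S \<longrightarrow> F {S, symp_orth \<omega> S} = mu \<omega> S) \<and>
              bij_betw F (symplectic_splittings \<omega>) (spacelike_lines \<omega>)) \<and>
         (\<forall>S. nondegenerate_plane \<omega> S \<longrightarrow>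
              plucker ` torus_of_splitting \<omega> S = torus_of_line \<omega> (mu \<omega> S))"
proof -
  interpret symplectic4 \<omega> using assms by unfold_locales
  show ?thesis using mu_bij plucker_torus by blast
qed

end
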